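(* Let $n\geq4$ be an integer. Consider pairs $(S,\theta)$ consisting of a real $n\times n$-matrix $S$ and a real number $\theta$ that satisfy, for some diagonal matrix $D$, the equations $$S=S^T,\quad S\odot\boldsymbol 1=0,\quad S\mathbf J=0,\quad S\odot S+S^2=\theta S+D. \qquad ( * )$$ For every $n\geq 4$ there is a solution $(S,\theta)$ of $( * )$ with $S\neq0$ and $\hat\theta\neq0$. A solution $(S,\theta)$ of $( * )$ such that the off-diagonal entries of $S$ assume precisely two distinct values exists if and only if $n=m\ell$ is a composite number or $n=p$ is a prime with $p\equiv1\pmod 4$. In the latter case ($n=p$ prime), such a two-valued solution has $\hat\theta=0$.
   Context: $\mathbf J$ is the $n\times n$ all-one matrix, $\boldsymbol1$ is the $n\times n$ identity matrix, and $\odot$ is the Hadamard (entrywise) product of matrices. For a solution $(S,\theta)$ with $S\neq0$ one puts $\hat\theta=\frac{|\theta|}{\|S\|_2}$, where $\|S\|_2=\big(\sum_{i,j}S_{i,j}^2\big)^{1/2}$. *)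

theory Defs
  imports
    Complex_Main
    "HOL-Computational_Algebra.Primes"
    "HOL-Number_Theory.Cong"
    "Jordan_Normal_Form.Matrix"
begin

definition all_one_mat :: "nat \<Rightarrow> real mat" where
  "all_one_mat n = mat n n (\<lambda>_. 1)"

definition hadamard_mat :: "real mat \<Rightarrow> real mat \<Rightarrow> real mat" (infixl \<open>\<odot>\<close> 70) where
  "A \<odot> B = mat (dim_row A) (dim_col A) (\<lambda>(i, j). A $$ (i, j) * B $$ (i, j))"

definition norm2_mat :: "real mat \<Rightarrow> real" where
  "norm2_mat A = sqrt (\<Sum>i<dim_row A. \<Sum>j<dim_col A. (A $$ (i, j))\<^sup>2)"

definition is_solution :: "nat \<Rightarrow> real mat \<Rightarrow> real \<Rightarrow> bool" where
  "is_solution n S \<theta> \<longleftrightarrow>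
     S \<in> carrier_mat n n \<and>
     (\<exists>D \<in> carrier_mat n n. diagonal_mat D \<and>
        S = transpose_mat S \<and>
        S \<odot> 1\<^sub>m n = 0\<^sub>m n n \<and>
        S * all_one_mat n = 0\<^sub>m n n \<and>
        S \<odot> S + S ^\<^sub>m 2 = \<theta> \<cdot>\<^sub>m S + D)"

(* Meaningful only for S \<noteq> 0; division by zero would yield 0 otherwise. *)
definition theta_hat :: "real mat \<Rightarrow> real \<Rightarrow> real" where
  "theta_hat S \<theta> = \<bar>\<theta>\<bar> / norm2_mat S"

definition offdiag_values :: "nat \<Rightarrow> real mat \<Rightarrow> real set" where
  "offdiag_values n S = {S $$ (i, j) | i j. i < n \<and> j < n \<and> i \<noteq> j}"

definition two_valued_solution :: "nat \<Rightarrow> real mat \<Rightarrow> real \<Rightarrow> bool" where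
  "two_valued_solution n S \<theta> \<longleftrightarrow> is_solution n S \<theta> \<and> card (offdiag_values n S) = 2"

end

theory Submission
  imports Defs
    "Jordan_Normal_Form.Schur_Decomposition"
    "HOL-Number_Theory.Euler_Criterion"
begin

text \<open>
  For any partition of the index set into blocks of size at least 2, the matrix with entries
  \<open>(n - m) / (m - 1)\<close> inside a block of size \<open>m\<close> and \<open>- 1\<close> between blocks solves the equations with
  \<open>\<theta> = n - 1\<close>; equal blocks give a two-valued solution.  For a prime \<open>n \<equiv> 1\<close> modulo 4 the Paley
  matrix of Legendre symbols is a two-valued solution with \<open>\<theta> = 0\<close>.

  Conversely, let \<open>S\<close> take the off-diagonal values \<open>a\<close> and \<open>b\<close>, where \<open>a\<close> occurs \<open>k\<close> times in each
  row.  Then the positions of \<open>a\<close> form a strongly regular graph, and the multiplicities \<open>f, g\<close> of the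
  two eigenvalues of \<open>S\<close> besides the constant vectors satisfy \<open>f + g = n - 1\<close>,
  \<open>f g D = n k (n - 1 - k)\<close> and \<open>(f - g)\<^sup>2 D = M\<^sup>2\<close> for integers \<open>D\<close> and \<open>M\<close>.  If \<open>n\<close> is prime and
  \<open>f \<noteq> g\<close>, then \<open>n\<^sup>2\<close> divides \<open>D\<close>, which is too large for the second equation.  So \<open>M = 0\<close>, the graph
  is a conference graph, and \<open>n = 4 \<mu> + 1\<close>, \<open>a = - b\<close>, \<open>\<theta> = 0\<close>.
\<close>

section \<open>The equations in entrywise form\<close>

text \<open>The free diagonal matrix \<open>D\<close> absorbs whatever stands on the diagonal, so
  the quadratic equation constrains only the entries with \<open>i \<noteq> j\<close>.\<close>

lemma is_solution_iff:
  "is_solution n S \<theta> \<longleftrightarrow>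
     S \<in> carrier_mat n n \<and>
     (\<forall>i<n. \<forall>j<n. S $$ (i, j) = S $$ (j, i)) \<and>
     (\<forall>i<n. S $$ (i, i) = 0) \<and>
     (\<forall>i<n. (\<Sum>l<n. S $$ (i, l)) = 0) \<and>
     (\<forall>i<n. \<forall>j<n. i \<noteq> j \<longrightarrow>
        (S $$ (i, j))\<^sup>2 + (\<Sum>l<n. S $$ (i, l) * S $$ (l, j)) = \<theta> * S $$ (i, j))"
    (is "?L \<longleftrightarrow> ?R")
proof (cases "S \<in> carrier_mat n n")
  case S: True
  have sq: "(S ^\<^sub>m 2) $$ (i, j) = (\<Sum>l<n. S $$ (i, l) * S $$ (l, j))" if "i < n" "j < n" for i j
    using that S by (auto simp: numeral_2_eq_2 scalar_prod_def atLeast0LessThan intro!: sum.cong)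
  have dims: "S ^\<^sub>m 2 \<in> carrier_mat n n" using S by simp
  have sym: "S = transpose_mat S \<longleftrightarrow> (\<forall>i<n. \<forall>j<n. S $$ (i, j) = S $$ (j, i))"
    using S by (auto simp: mat_eq_iff)
  have diag: "S \<odot> 1\<^sub>m n = 0\<^sub>m n n \<longleftrightarrow> (\<forall>i<n. S $$ (i, i) = 0)"
    using S by (auto simp: mat_eq_iff hadamard_mat_def)
  have rows: "S * all_one_mat n = 0\<^sub>m n n \<longleftrightarrow> (\<forall>i<n. (\<Sum>l<n. S $$ (i, l)) = 0)"
    using S by (auto simp: mat_eq_iff all_one_mat_def scalar_prod_def atLeast0LessThan
        intro!: sum.cong)
  have quad: "(\<exists>D \<in> carrier_mat n n. diagonal_mat D \<and> S \<odot> S + S ^\<^sub>m 2 = \<theta> \<cdot>\<^sub>m S + D) \<longleftrightarrow>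
     (\<forall>i<n. \<forall>j<n. i \<noteq> j \<longrightarrow>
        (S $$ (i, j))\<^sup>2 + (\<Sum>l<n. S $$ (i, l) * S $$ (l, j)) = \<theta> * S $$ (i, j))"
      (is "?A \<longleftrightarrow> ?B")
  proof
    assume ?A
    then obtain D where D: "D \<in> carrier_mat n n" "diagonal_mat D"
      and e: "S \<odot> S + S ^\<^sub>m 2 = \<theta> \<cdot>\<^sub>m S + D" by blast
    show ?B
    proof (intro allI impI)
      fix i j assume ij: "i < n" "j < n" "i \<noteq> j"
      have "(S \<odot> S + S ^\<^sub>m 2) $$ (i, j) = (\<theta> \<cdot>\<^sub>m S + D) $$ (i, j)" using e by simp
      then show "(S $$ (i, j))\<^sup>2 + (\<Sum>l<n. S $$ (i, l) * S $$ (l, j)) = \<theta> * S $$ (i, j)"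
        using ij S D dims sq[OF ij(1,2)]
        by (auto simp: hadamard_mat_def power2_eq_square diagonal_mat_def)
    qed
  next
    assume B: ?B
    define D where "D = mat n n (\<lambda>(i, j). if i = j then (S \<odot> S + S ^\<^sub>m 2) $$ (i, i) - \<theta> * S $$ (i, i) else 0)"
    have "S \<odot> S + S ^\<^sub>m 2 = \<theta> \<cdot>\<^sub>m S + D"
    proof (rule eq_matI)
      fix i j assume "i < dim_row (\<theta> \<cdot>\<^sub>m S + D)" "j < dim_col (\<theta> \<cdot>\<^sub>m S + D)"
      then have ij: "i < n" "j < n" by (auto simp: D_def)
      show "(S \<odot> S + S ^\<^sub>m 2) $$ (i, j) = (\<theta> \<cdot>\<^sub>m S + D) $$ (i, j)"
      proof (cases "i = j")
        case True then show ?thesis using ij S by (simp add: D_def)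
      next
        case False
        then show ?thesis using ij S dims B sq[OF ij]
          by (auto simp: D_def hadamard_mat_def power2_eq_square)
      qed
    qed (use S dims in \<open>auto simp: D_def hadamard_mat_def\<close>)
    moreover have "D \<in> carrier_mat n n" "diagonal_mat D" by (auto simp: D_def diagonal_mat_def)
    ultimately show ?A by blast
  qed
  show ?thesis unfolding is_solution_def using S sym diag rows quad by blast
next
  case False
  then show ?thesis by (simp add: is_solution_def)
qed

section \<open>Traces of idempotent matrices\<close>

lemma trace_mult_commute:
  fixes A B :: "'a :: comm_semiring_0 mat"
  assumes "A \<in> carrier_mat n m" "B \<in> carrier_mat m n"
  shows "(\<Sum>i<n. (A * B) $$ (i, i)) = (\<Sum>i<m. (B * A) $$ (i, i))"
proof -
  have "(\<Sum>i<n. (A * B) $$ (i, i)) = (\<Sum>i<n. \<Sum>l<m. A $$ (i, l) * B $$ (l, i))"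
    using assms by (auto simp: scalar_prod_def atLeast0LessThan intro!: sum.cong)
  also have "\<dots> = (\<Sum>l<m. \<Sum>i<n. B $$ (l, i) * A $$ (i, l))"
    by (subst sum.swap) (simp add: mult.commute)
  also have "\<dots> = (\<Sum>i<m. (B * A) $$ (i, i))"
    using assms by (auto simp: scalar_prod_def atLeast0LessThan intro!: sum.cong)
  finally show ?thesis .
qed

text \<open>The Schur form \<open>B\<close> of \<open>E\<close> is triangular and idempotent, so its
  diagonal entries are 0 or 1; the trace, invariant under similarity, counts the ones.\<close>

lemma trace_idempotent_nat:
  fixes E :: "complex mat"
  assumes E: "E \<in> carrier_mat n n" and idem: "E * E = E"
  obtains f :: nat where "(\<Sum>i<n. E $$ (i, i)) = of_nat f"
proof -
  obtain es where "char_poly E = (\<Prod>a\<leftarrow>es. [:- a, 1:])"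
    using char_poly_factorized[OF E] by blast
  from schur_decomposition_exists[OF E this]
  obtain B where B: "B \<in> carrier_mat n n" "upper_triangular B" and "similar_mat E B" by blast
  then obtain P Q where w: "similar_mat_wit E B P Q" unfolding similar_mat_def by blast
  note PQ = similar_mat_witD2[OF E w]
  have c: "P \<in> carrier_mat n n" "Q \<in> carrier_mat n n" using PQ by auto
  have QE: "Q * E = B * Q"
  proof -
    have "Q * E = Q * (P * (B * Q))" using PQ B c by (simp add: assoc_mult_mat[of _ n n _ n _ n])
    also have "\<dots> = (Q * P) * (B * Q)" using B c by (simp add: assoc_mult_mat[of _ n n _ n _ n])
    finally show ?thesis using PQ B c by simp
  qed
  have BB: "B * B = B"
  proof -
    have "B * B = B * (B * (Q * P))" using PQ B c by simp
    also have "\<dots> = B * (Q * E * P)" using B c QE by (simp add: assoc_mult_mat[of _ n n _ n _ n])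
    also have "\<dots> = (B * Q) * E * P" using B c E by (simp add: assoc_mult_mat[of _ n n _ n _ n])
    also have "\<dots> = Q * (E * E) * P" using B c E QE[symmetric] by (simp add: assoc_mult_mat[of _ n n _ n _ n])
    also have "\<dots> = B * (Q * P)" using B c QE idem by (simp add: assoc_mult_mat[of _ n n _ n _ n])
    finally show ?thesis using PQ B c by simp
  qed
  have diag: "B $$ (i, i) = 0 \<or> B $$ (i, i) = 1" if i: "i < n" for i
  proof -
    have "B $$ (i, l) * B $$ (l, i) = (if l = i then (B $$ (i, i))\<^sup>2 else 0)" if "l < n" for l
      using B i that by (cases l i rule: linorder_cases) (auto simp: power2_eq_square upper_triangular_def)
    then have "(B * B) $$ (i, i) = (\<Sum>l<n. if l = i then (B $$ (i, i))\<^sup>2 else 0)"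
      using B i by (auto simp: scalar_prod_def atLeast0LessThan intro!: sum.cong)
    then have "B $$ (i, i) = (B $$ (i, i))\<^sup>2" using i BB by simp
    then show ?thesis by (simp add: power2_eq_square)
  qed
  have "(\<Sum>i<n. E $$ (i, i)) = (\<Sum>i<n. (P * (B * Q)) $$ (i, i))"
    using PQ B c by (simp add: assoc_mult_mat[of _ n n _ n _ n])
  also have "\<dots> = (\<Sum>i<n. ((B * Q) * P) $$ (i, i))"
    using B c by (intro trace_mult_commute) auto
  also have "(B * Q) * P = B * (Q * P)" using B c by (simp add: assoc_mult_mat[of _ n n _ n _ n])
  also have "\<dots> = B" using PQ B by simp
  also have "(\<Sum>i<n. B $$ (i, i)) = (\<Sum>i<n. of_nat (if B $$ (i, i) = 1 then 1 else 0))"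
    using diag by (intro sum.cong) auto
  also have "\<dots> = of_nat (\<Sum>i<n. if B $$ (i, i) = 1 then 1 else 0)" by simp
  finally show ?thesis by (rule that)
qed

text \<open>Triangularisation needs a split characteristic polynomial, hence the detour through the
  complex numbers.\<close>

lemma trace_idempotent_nat_real:
  fixes E :: "real mat"
  assumes E: "E \<in> carrier_mat n n" and idem: "E * E = E"
  obtains f :: nat where "(\<Sum>i<n. E $$ (i, i)) = of_nat f"
proof -
  let ?E = "map_mat complex_of_real E"
  have "?E * ?E = ?E" using of_real_hom.mat_hom_mult[OF E E] idem by metis
  then obtain f :: nat where f: "(\<Sum>i<n. ?E $$ (i, i)) = of_nat f"
    using trace_idempotent_nat[of ?E n] E by auto
  have "(\<Sum>i<n. ?E $$ (i, i)) = complex_of_real (\<Sum>i<n. E $$ (i, i))" using E by simp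
  then have "(\<Sum>i<n. E $$ (i, i)) = of_nat f" using f by (metis of_real_eq_iff of_real_of_nat_eq)
  then show ?thesis by (rule that)
qed

section \<open>Two-valued solutions of prime order\<close>

lemma prime_feasibility:
  fixes p f g k N D :: int
  assumes p: "prime p" "p \<ge> 4" and k: "0 < k" "k < p - 1"
    and fg: "f + g = p - 1" and 1: "f * g * D = p * (k * (p - 1 - k))" and 2: "(f - g)\<^sup>2 * D = N\<^sup>2"
  shows "N = 0"
proof (cases "f = g")
  case True
  then show ?thesis using 2 by simp
next
  case False
  have rhs: "p * (k * (p - 1 - k)) > 0" using p k by simp
  have "D \<ge> 0"
  proof (rule ccontr)
    assume "\<not> D \<ge> 0"
    moreover have "(f - g)\<^sup>2 > 0" using False by simp
    ultimately have "(f - g)\<^sup>2 * D < 0" by (simp add: mult_pos_neg)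
    then show False using 2 by (metis not_less zero_le_power2)
  qed
  moreover have "D \<noteq> 0" using 1 rhs by auto
  ultimately have D: "D > 0" by simp
  then have "f * g > 0" using 1 rhs by (metis zero_less_mult_pos2)
  then have pos: "f > 0" "g > 0" using fg p by (auto simp: zero_less_mult_iff)
  \<comment> \<open>All three numbers are nonzero and smaller than \<open>p\<close> in absolute
    value.\<close>
  have nd: "\<not> p dvd f" "\<not> p dvd g" "\<not> p dvd (f - g)"
    using dvd_imp_le_int[of f p] dvd_imp_le_int[of g p] dvd_imp_le_int[of "f - g" p]
      pos fg False by auto
  have "p dvd f * g * D" using 1 by simp
  then have pD: "p dvd D" using p nd by (simp add: prime_dvd_mult_iff)
  \<comment> \<open>The square in \<open>2\<close> doubles the power of \<open>p\<close>: from
    \<open>p dvd N\<close>, \<open>p\<^sup>2\<close> divides the left side, whose factor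
    \<open>(f - g)\<^sup>2\<close> is coprime to \<open>p\<close>.\<close>
  then have "p dvd N\<^sup>2" using 2 by (metis dvd_mult)
  then have "p dvd N" using p prime_dvd_power by blast
  then have "p\<^sup>2 dvd (f - g)\<^sup>2 * D" using 2 by simp
  moreover have "coprime (p\<^sup>2) ((f - g)\<^sup>2)"
    using p nd by (simp add: prime_imp_coprime)
  ultimately have "p\<^sup>2 dvd D" using coprime_dvd_mult_right_iff by blast
  then have "D \<ge> p\<^sup>2" using D by (simp add: zdvd_imp_le)
  moreover have "f * g \<ge> p - 2"
  proof -
    have "(f - 1) * (g - 1) \<ge> 0" using pos by simp
    then show ?thesis using fg by (simp add: algebra_simps)
  qed
  \<comment> \<open>Both \<open>k\<close> and \<open>p - 1 - k\<close> are at most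
    \<open>p - 2\<close>, so the right side of \<open>1\<close> is at most
    \<open>p * (p - 2)\<^sup>2\<close>, which is below this bound.\<close>
  ultimately have "f * g * D \<ge> (p - 2) * p\<^sup>2"
    using p by (intro mult_mono) auto
  then have "p * (k * (p - 1 - k)) \<ge> p * ((p - 2) * p)" using 1 by (simp add: power2_eq_square ac_simps)
  then have "k * (p - 1 - k) \<ge> (p - 2) * p" using p by simp
  moreover have "k * (p - 1 - k) \<le> (p - 2) * (p - 2)" using k by (intro mult_mono) auto
  moreover have "(p - 2) * (p - 2) < (p - 2) * p" using p by simp
  ultimately show ?thesis by simp
qed

text \<open>Besides the constant vectors, \<open>S\<close> has the two eigenvalues \<open>r, s\<close> given by
  \<open>x\<^sup>2 = \<tau> x + q n\<close>, and \<open>(S - s P) / (r - s)\<close>, where \<open>P = 1 - J / n\<close>, is the projection onto the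
  \<open>r\<close>-eigenspace.  So \<open>f\<close> and \<open>n - 1 - f\<close> are the two multiplicities.\<close>
lemma eigenvalue_multiplicities:
  fixes S :: "real mat"
  assumes S: "S \<in> carrier_mat n n" and n: "n > 0"
    and sym: "\<And>i j. i < n \<Longrightarrow> j < n \<Longrightarrow> S $$ (i, j) = S $$ (j, i)"
    and diag: "\<And>i. i < n \<Longrightarrow> S $$ (i, i) = 0"
    and row: "\<And>i. i < n \<Longrightarrow> (\<Sum>l<n. S $$ (i, l)) = 0"
    and sq: "\<And>i j. i < n \<Longrightarrow> j < n \<Longrightarrow>
      (\<Sum>l<n. S $$ (i, l) * S $$ (l, j)) = \<tau> * S $$ (i, j) + q * ((if i = j then real n else 0) - 1)"
    and q: "q > 0"
  obtains f :: nat where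
    "real f * (real n - 1 - real f) * (\<tau>\<^sup>2 + 4 * q * real n) = q * real n * (real n - 1)\<^sup>2"
    "(real f - (real n - 1 - real f))\<^sup>2 * (\<tau>\<^sup>2 + 4 * q * real n) = \<tau>\<^sup>2 * (real n - 1)\<^sup>2"
proof -
  \<comment> \<open>\<open>R\<close> is \<open>r - s\<close>, the root of the discriminant, and
    \<open>s\<close> is the smaller eigenvalue.\<close>
  define R where "R = sqrt (\<tau>\<^sup>2 + 4 * q * real n)"
  have pos: "\<tau>\<^sup>2 + 4 * q * real n > 0" using q n by (simp add: add_nonneg_pos)
  have R: "R > 0" "R\<^sup>2 = \<tau>\<^sup>2 + 4 * q * real n" using pos by (auto simp: R_def)
  define s where "s = (\<tau> - R) / 2"
  have s: "\<tau> - 2 * s = R" "q * real n + s\<^sup>2 = - s * R"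
    using R(2) by (auto simp: s_def power2_eq_square field_simps)
  define P where "P = (\<lambda>i j :: nat. (if i = j then 1 else 0) - 1 / real n)"
  have Pmul: "(\<Sum>l<n. x l * P l j) = x j - (\<Sum>l<n. x l) / real n" if "j < n" for x :: "nat \<Rightarrow> real" and j
  proof -
    have "(\<Sum>l<n. x l * P l j) = (\<Sum>l<n. (if l = j then x j else 0) - x l / real n)"
      by (intro sum.cong) (auto simp: P_def algebra_simps)
    then show ?thesis using that by (simp add: sum_subtractf sum_divide_distrib)
  qed
  have Psym: "P i j = P j i" for i j by (simp add: P_def)
  have Prow: "(\<Sum>l<n. P i l) = 0" if "i < n" for i
    using that n by (simp add: P_def sum_subtractf)
  define E where "E = mat n n (\<lambda>(i, j). (S $$ (i, j) - s * P i j) / R)"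
  have E: "E \<in> carrier_mat n n" by (simp add: E_def)
  have "E * E = E"
  proof (rule eq_matI)
    fix i j assume "i < dim_row E" "j < dim_col E"
    then have ij: "i < n" "j < n" by (auto simp: E_def)
    have SP: "(\<Sum>l<n. S $$ (i, l) * P l j) = S $$ (i, j)" using Pmul[OF ij(2)] row[OF ij(1)] by simp
    have PS: "(\<Sum>l<n. P i l * S $$ (l, j)) = S $$ (i, j)"
    proof -
      have "(\<Sum>l<n. P i l * S $$ (l, j)) = (\<Sum>l<n. S $$ (j, l) * P l i)"
        using ij sym[of _ j] by (intro sum.cong) (auto simp: Psym[of i] mult.commute)
      then show ?thesis using Pmul[OF ij(1)] row[OF ij(2)] sym[OF ij] by simp
    qed
    have PP: "(\<Sum>l<n. P i l * P l j) = P i j" using Pmul[OF ij(2)] Prow[OF ij(1)] by simp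
    \<comment> \<open>Hence \<open>sq\<close> reads \<open>S\<^sup>2 = \<tau> S + q n P\<close>;
      with \<open>S P = P S = S\<close> and \<open>P P = P\<close> this makes \<open>E\<close>
      idempotent.\<close>
    have qP: "q * ((if i = j then real n else 0) - 1) = q * real n * P i j"
      using n by (auto simp: P_def field_simps)
    have "(E * E) $$ (i, j) = (\<Sum>l<n. (S $$ (i, l) - s * P i l) / R * ((S $$ (l, j) - s * P l j) / R))"
      using ij by (auto simp: E_def scalar_prod_def atLeast0LessThan intro!: sum.cong)
    also have "\<dots> = (\<Sum>l<n. S $$ (i, l) * S $$ (l, j) - s * (S $$ (i, l) * P l j)
        - s * (P i l * S $$ (l, j)) + s\<^sup>2 * (P i l * P l j)) / R\<^sup>2"
      unfolding sum_divide_distrib using R(1)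
      by (intro sum.cong) (auto simp: field_simps power2_eq_square)
    also have "\<dots> = ((\<Sum>l<n. S $$ (i, l) * S $$ (l, j)) - s * (\<Sum>l<n. S $$ (i, l) * P l j)
        - s * (\<Sum>l<n. P i l * S $$ (l, j)) + s\<^sup>2 * (\<Sum>l<n. P i l * P l j)) / R\<^sup>2"
      by (simp add: sum.distrib sum_subtractf sum_distrib_left)
    also have "\<dots> = (\<tau> * S $$ (i, j) + q * real n * P i j - s * S $$ (i, j) - s * S $$ (i, j) + s\<^sup>2 * P i j) / R\<^sup>2"
      unfolding sq[OF ij] SP PS PP qP by simp
    also have "\<dots> = ((\<tau> - 2 * s) * S $$ (i, j) + (q * real n + s\<^sup>2) * P i j) / R\<^sup>2"
      by (simp add: algebra_simps)
    also have "\<dots> = (S $$ (i, j) - s * P i j) / R"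
      unfolding s using R(1) by (simp add: power2_eq_square field_simps)
    finally show "(E * E) $$ (i, j) = E $$ (i, j)" using ij by (simp add: E_def)
  qed (auto simp: E_def)
  then obtain f :: nat where f: "(\<Sum>i<n. E $$ (i, i)) = of_nat f"
    using trace_idempotent_nat_real[OF E] by blast
  \<comment> \<open>As \<open>S\<close> has zero diagonal, only \<open>- s P\<close> contributes to
    the trace.\<close>
  have "(\<Sum>i<n. E $$ (i, i)) = (\<Sum>i<n. - s * (1 - 1 / real n) / R)"
    by (intro sum.cong) (auto simp: E_def P_def diag)
  also have "\<dots> = - s * (real n * (1 - 1 / real n)) / R" by simp
  also have "real n * (1 - 1 / real n) = real n - 1" using n by (simp add: field_simps)
  finally have fR: "real f * R = - s * (real n - 1)" using f R(1) by (simp add: field_simps)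
  \<comment> \<open>\<open>R + s\<close> is the larger root \<open>r\<close>. The product of the
    multiplicities brings in \<open>- r s = q n\<close>, their difference
    \<open>r + s = \<tau>\<close>.\<close>
  have gR: "(real n - 1 - real f) * R = (R + s) * (real n - 1)"
    using fR by (simp add: algebra_simps)
  have "real f * (real n - 1 - real f) * R\<^sup>2 = (real f * R) * ((real n - 1 - real f) * R)"
    by (simp add: power2_eq_square)
  also have "\<dots> = (- s * R - s\<^sup>2) * (real n - 1)\<^sup>2"
    unfolding fR gR by (simp add: power2_eq_square algebra_simps)
  also have "- s * R - s\<^sup>2 = q * real n" using s(2) by simp
  finally have 1: "real f * (real n - 1 - real f) * (\<tau>\<^sup>2 + 4 * q * real n) = q * real n * (real n - 1)\<^sup>2"
    unfolding R(2) .
  have "(real f - (real n - 1 - real f))\<^sup>2 * R\<^sup>2 = (real f * R - (real n - 1 - real f) * R)\<^sup>2"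
    by (simp add: power2_eq_square algebra_simps)
  also have "\<dots> = ((R + 2 * s) * (real n - 1))\<^sup>2"
    unfolding fR gR by (simp add: power2_eq_square algebra_simps)
  also have "R + 2 * s = \<tau>" using s(1) by simp
  finally have 2: "(real f - (real n - 1 - real f))\<^sup>2 * (\<tau>\<^sup>2 + 4 * q * real n) = \<tau>\<^sup>2 * (real n - 1)\<^sup>2"
    unfolding R(2) by (simp add: power_mult_distrib)
  show ?thesis using that 1 2 .
qed

lemma two_valued_prime:
  assumes tv: "two_valued_solution n S \<theta>" and p: "prime n" and n4: "n \<ge> 4"
  shows "\<theta> = 0 \<and> [n = 1] (mod 4)"
proof -
  from tv have S: "S \<in> carrier_mat n n"
    and sym: "\<And>i j. i < n \<Longrightarrow> j < n \<Longrightarrow> S $$ (i, j) = S $$ (j, i)"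
    and diag: "\<And>i. i < n \<Longrightarrow> S $$ (i, i) = 0"
    and row: "\<And>i. i < n \<Longrightarrow> (\<Sum>l<n. S $$ (i, l)) = 0"
    and quad: "\<And>i j. i < n \<Longrightarrow> j < n \<Longrightarrow> i \<noteq> j \<Longrightarrow>
       (S $$ (i, j))\<^sup>2 + (\<Sum>l<n. S $$ (i, l) * S $$ (l, j)) = \<theta> * S $$ (i, j)"
    and card2: "card (offdiag_values n S) = 2"
    unfolding two_valued_solution_def is_solution_iff by blast+
  from card2 obtain a b where ab: "a \<noteq> b" "offdiag_values n S = {a, b}"
    by (meson card_2_iff)
  have val: "S $$ (i, j) = a \<or> S $$ (i, j) = b" if "i < n" "j < n" "i \<noteq> j" for i j
    using ab(2) that unfolding offdiag_values_def by blast
  have "a \<in> offdiag_values n S" "b \<in> offdiag_values n S" using ab(2) by auto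
  then obtain i1 j1 i2 j2 where
    e1: "i1 < n" "j1 < n" "i1 \<noteq> j1" "S $$ (i1, j1) = a" and
    e2: "i2 < n" "j2 < n" "i2 \<noteq> j2" "S $$ (i2, j2) = b"
    unfolding offdiag_values_def by blast
  define w where "w = a - b"
  have w: "w \<noteq> 0" using ab by (simp add: w_def)
  define N where "N = (\<lambda>i. {l. l < n \<and> l \<noteq> i \<and> S $$ (i, l) = a})"
  have fin: "finite (N i)" for i by (simp add: N_def)
  \<comment> \<open>The right side does not depend on \<open>i\<close>: zero row sums make the graph
    of the entries \<open>a\<close> regular.\<close>
  have deg: "real (card (N i)) * w = - (real n - 1) * b" if i: "i < n" for i
  proof -
    have "(\<Sum>l<n. S $$ (i, l)) = (\<Sum>l<n. w * (if l \<in> N i then 1 else 0) + (b - (if l = i then b else 0)))"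
      using val[OF i] diag[OF i] by (intro sum.cong) (auto simp: N_def w_def)
    also have "\<dots> = w * (\<Sum>l<n. if l \<in> N i then 1 else 0) + (real n * b - b)"
      using i by (simp add: sum.distrib sum_subtractf sum_distrib_left)
    also have "(\<Sum>l<n. if l \<in> N i then 1 else (0::real)) = (\<Sum>l\<in>N i. 1)"
      by (intro sum.mono_neutral_cong_right) (auto simp: N_def)
    finally show ?thesis using row[OF i] by (simp add: algebra_simps)
  qed
  define k where "k = card (N i1)"
  have kw: "real k * w = - (real n - 1) * b" using deg[OF e1(1)] by (simp add: k_def)
  have k0: "0 < k" using e1 fin[of i1] unfolding k_def card_gt_0_iff by (auto simp: N_def)
  have k1: "k < n - 1"
  proof -
    have "real k * w = real (card (N i2)) * w" using kw deg[OF e2(1)] by simp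
    then have "k = card (N i2)" using w by simp
    also have "\<dots> \<le> card ({..<n} - {i2, j2})"
      using e2 ab(1) by (intro card_mono) (auto simp: N_def)
    also have "\<dots> = n - 2" using e2 by (simp add: card_Diff_subset)
    finally show ?thesis using n4 by simp
  qed
  \<comment> \<open>Both values satisfy \<open>x\<^sup>2 = (a + b) * x + q\<close>. This turns the
    Hadamard square into a linear term, so that \<open>S\<^sup>2\<close> is
    \<open>\<tau> S - q\<close> off the diagonal.\<close>
  define q where "q = - a * b"
  have qn: "q * (real n - 1)\<^sup>2 = real k * (real n - 1 - real k) * w\<^sup>2"
  proof -
    have "q * (real n - 1)\<^sup>2 = - ((real n - 1) * a) * ((real n - 1) * b)"
      by (simp add: q_def power2_eq_square)
    also have "(real n - 1) * a = (real n - 1 - real k) * w" using kw by (simp add: w_def algebra_simps)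
    also have "(real n - 1) * b = - real k * w" using kw by (simp add: w_def algebra_simps)
    finally show ?thesis by (simp add: power2_eq_square)
  qed
  have q: "q > 0"
  proof -
    have "q * (real n - 1)\<^sup>2 > 0" unfolding qn using k0 k1 w by simp
    then show ?thesis by (simp add: zero_less_mult_iff)
  qed
  define \<tau> where "\<tau> = \<theta> - a - b"
  have sqo: "(\<Sum>l<n. S $$ (i, l) * S $$ (l, j)) = \<tau> * S $$ (i, j) - q" if ij: "i < n" "j < n" "i \<noteq> j" for i j
    using quad[OF ij] val[OF ij] by (auto simp: \<tau>_def q_def power2_eq_square algebra_simps)
  have sq: "(\<Sum>l<n. S $$ (i, l) * S $$ (l, j)) = \<tau> * S $$ (i, j) + q * ((if i = j then real n else 0) - 1)"
    if ij: "i < n" "j < n" for i j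
  proof (cases "i = j")
    case True
    have "(\<Sum>l<n. S $$ (i, l) * S $$ (l, i)) = (\<Sum>l<n. (a + b) * S $$ (i, l) + (q - (if l = i then q else 0)))"
    proof (rule sum.cong)
      fix l assume "l \<in> {..<n}"
      then show "S $$ (i, l) * S $$ (l, i) = (a + b) * S $$ (i, l) + (q - (if l = i then q else 0))"
        using sym[of l i] diag[OF ij(1)] val[OF ij(1), of l] ij(1)
        by (cases "l = i") (auto simp: q_def algebra_simps)
    qed simp
    also have "\<dots> = (a + b) * (\<Sum>l<n. S $$ (i, l)) + (real n * q - q)"
      using ij by (simp add: sum.distrib sum_subtractf sum_distrib_left)
    finally show ?thesis using True row[OF ij(1)] diag[OF ij(1)] by (simp add: algebra_simps)
  next
    case False
    then show ?thesis using sqo[OF ij] by simp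
  qed
  \<comment> \<open>After subtracting \<open>b\<close>, the product of two entries is
    \<open>w\<^sup>2\<close> at a common neighbour and 0 at any other \<open>l\<close> outside
    \<open>{i, j}\<close>. Those two indices are treated apart because the diagonal is 0 and not
    \<open>b\<close>.\<close>
  have common: "w\<^sup>2 * real (card (N i \<inter> N j)) = \<tau> * S $$ (i, j) - q + real n * b\<^sup>2 + 2 * b * (S $$ (i, j) - b)"
    if ij: "i < n" "j < n" "i \<noteq> j" for i j
  proof -
    let ?g = "\<lambda>l. (S $$ (i, l) - b) * (S $$ (l, j) - b)"
    have "w\<^sup>2 * real (card (N i \<inter> N j)) = (\<Sum>l\<in>N i \<inter> N j. w\<^sup>2)" by simp
    also have "\<dots> = (\<Sum>l\<in>{..<n} - {i, j}. ?g l)"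
    proof (rule sum.mono_neutral_cong_left)
      show "\<forall>l\<in>{..<n} - {i, j} - N i \<inter> N j. ?g l = 0"
        using val ij sym[of _ j] by (auto simp: N_def)
      show "w\<^sup>2 = ?g l" if "l \<in> N i \<inter> N j" for l
        using that ij sym[of l j] by (auto simp: N_def w_def power2_eq_square)
    qed (auto simp: N_def)
    also have "\<dots> = (\<Sum>l<n. ?g l) - (\<Sum>l\<in>{i, j}. ?g l)"
      using ij by (intro sum_diff) auto
    also have "(\<Sum>l\<in>{i, j}. ?g l) = - 2 * b * (S $$ (i, j) - b)"
      using ij diag by (simp add: algebra_simps)
    also have "(\<Sum>l<n. ?g l) = (\<Sum>l<n. S $$ (i, l) * S $$ (l, j) - b * S $$ (i, l) - b * S $$ (j, l) + b\<^sup>2)"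
      using sym[OF _ ij(2)] by (intro sum.cong) (auto simp: algebra_simps power2_eq_square)
    also have "\<dots> = (\<Sum>l<n. S $$ (i, l) * S $$ (l, j)) - b * (\<Sum>l<n. S $$ (i, l))
        - b * (\<Sum>l<n. S $$ (j, l)) + real n * b\<^sup>2"
      by (simp add: sum.distrib sum_subtractf sum_distrib_left)
    finally show ?thesis using row ij sqo[OF ij] by simp
  qed
  \<comment> \<open>\<open>\<mu>\<close> counts the common neighbours of a non-adjacent pair;
    \<open>t\<close> is \<open>\<lambda> - \<mu>\<close> in the usual parameters of a strongly
    regular graph.\<close>
  define \<mu> where "\<mu> = int (card (N i2 \<inter> N j2))"
  define t where "t = int (card (N i1 \<inter> N j1)) - \<mu>"
  have mu: "w\<^sup>2 * \<mu> = \<tau> * b - q + real n * b\<^sup>2"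
    using common[OF e2(1-3)] e2(4) by (simp add: \<mu>_def)
  have "w\<^sup>2 * t = w * (\<tau> + 2 * b)"
    using common[OF e1(1-3)] mu e1(4) by (simp add: t_def w_def algebra_simps power2_eq_square)
  then have tw: "w * t = \<tau> + 2 * b" using w by (simp add: power2_eq_square)
  \<comment> \<open>\<open>D\<close> is the discriminant of the adjacency eigenvalues. Up to factors
    \<open>w\<^sup>2\<close> and \<open>w\<close>, the integers \<open>D\<close> and
    \<open>M\<close> are \<open>\<tau>\<^sup>2 + 4 * q * n\<close> and
    \<open>(n - 1) * \<tau>\<close>.\<close>
  define D where "D = t\<^sup>2 + 4 * (int k - \<mu>)"
  define M where "M = (int n - 1) * t + 2 * int k"
  have Mw: "w * M = (real n - 1) * \<tau>"
  proof -
    have "w * M = (real n - 1) * (w * t) + 2 * (real k * w)"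
      using n4 by (simp add: M_def of_nat_diff algebra_simps)
    then show ?thesis unfolding tw kw by (simp add: algebra_simps)
  qed
  have Dw: "w\<^sup>2 * D = \<tau>\<^sup>2 + 4 * q * real n"
  proof -
    have "w\<^sup>2 * D = (w * t)\<^sup>2 + 4 * w * (real k * w) - 4 * (w\<^sup>2 * \<mu>)"
      by (simp add: D_def power2_eq_square algebra_simps)
    then show ?thesis unfolding tw kw mu by (simp add: q_def w_def power2_eq_square algebra_simps)
  qed
  obtain f :: nat where
    f1: "real f * (real n - 1 - real f) * (\<tau>\<^sup>2 + 4 * q * real n) = q * real n * (real n - 1)\<^sup>2" and
    f2: "(real f - (real n - 1 - real f))\<^sup>2 * (\<tau>\<^sup>2 + 4 * q * real n) = \<tau>\<^sup>2 * (real n - 1)\<^sup>2"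
    using eigenvalue_multiplicities[OF S _ sym diag row sq q] n4 by auto
  \<comment> \<open>Dividing by \<open>w\<^sup>2\<close> carries the real identities
    \<open>f1\<close> and \<open>f2\<close> over to the integers, where divisibility by
    \<open>n\<close> can be used.\<close>
  have cancel: "x = y" if "w\<^sup>2 * real_of_int x = w\<^sup>2 * real_of_int y" for x y
    using that w by simp
  define g where "g = int n - 1 - int f"
  have g: "real_of_int g = real n - 1 - real f" by (simp add: g_def)
  have "w\<^sup>2 * real_of_int (int f * g * D) = w\<^sup>2 * real_of_int (int n * (int k * (int n - 1 - int k)))"
  proof -
    have "w\<^sup>2 * real_of_int (int f * g * D) = real f * (real n - 1 - real f) * (w\<^sup>2 * D)"
      by (simp add: g algebra_simps)
    also have "\<dots> = real n * (q * (real n - 1)\<^sup>2)" unfolding Dw f1 by simp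
    finally show ?thesis unfolding qn by (simp add: mult.assoc)
  qed
  then have F1: "int f * g * D = int n * (int k * (int n - 1 - int k))" by (rule cancel)
  have "w\<^sup>2 * real_of_int ((int f - g)\<^sup>2 * D) = w\<^sup>2 * real_of_int (M\<^sup>2)"
  proof -
    have "w\<^sup>2 * real_of_int ((int f - g)\<^sup>2 * D) = (real f - (real n - 1 - real f))\<^sup>2 * (w\<^sup>2 * D)"
      by (simp add: g algebra_simps)
    also have "\<dots> = (w * M)\<^sup>2" unfolding Dw f2 Mw by (simp add: power_mult_distrib)
    finally show ?thesis by (simp add: power_mult_distrib)
  qed
  then have F2: "(int f - g)\<^sup>2 * D = M\<^sup>2" by (rule cancel)
  have "M = 0"
    by (rule prime_feasibility[OF _ _ _ _ _ F1 F2]) (use p n4 k0 k1 in \<open>auto simp: g_def\<close>)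
  then have kt: "(int n - 1) * (- t) = 2 * int k" and \<tau>: "\<tau> = 0"
    using Mw n4 by (auto simp: M_def)
  \<comment> \<open>Since \<open>2 * k\<close> lies strictly between 0 and
    \<open>2 * (n - 1)\<close>, the integer \<open>- t\<close> can only be 1.\<close>
  have "0 < (int n - 1) * (- t)" "(int n - 1) * (- t) < (int n - 1) * 2"
    unfolding kt using k0 k1 by auto
  then have "0 < - t" "- t < 2"
    using n4 zero_less_mult_pos[of "int n - 1" "- t"] mult_less_cancel_left_pos[of "int n - 1" "- t" 2]
    by auto
  then have "t = - 1" by simp
  then have "2 * int k = int n - 1" using kt by simp
  then have k2: "2 * real k = real n - 1" using n4 by linarith
  \<comment> \<open>With \<open>k\<close> half of \<open>n - 1\<close>, zero row sums force
    \<open>a = - b\<close>, and \<open>\<tau> = 0\<close> becomes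
    \<open>\<theta> = 0\<close>.\<close>
  have b2: "b = - w / 2"
  proof -
    have "(real n - 1) * (2 * b + w) = 2 * ((real n - 1) * b) + 2 * real k * w"
      unfolding k2 by (simp add: algebra_simps)
    also have "\<dots> = 0" using kw by (simp add: algebra_simps)
    finally have "2 * b + w = 0" using n4 by simp
    then show ?thesis by simp
  qed
  then have a2: "a = w / 2" by (simp add: w_def)
  have "\<theta> = 0" using \<tau> a2 b2 by (simp add: \<tau>_def)
  \<comment> \<open>Now \<open>q\<close> and \<open>b\<^sup>2\<close> both equal
    \<open>w\<^sup>2 / 4\<close> in \<open>mu\<close>; that \<open>\<mu>\<close> is an integer gives
    the congruence.\<close>
  moreover have "4 * \<mu> = int n - 1"
  proof -
    have "w\<^sup>2 * (4 * real_of_int \<mu>) = w\<^sup>2 * (real n - 1)"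
      using mu \<tau> unfolding q_def a2 b2 by (simp add: power2_eq_square algebra_simps)
    then have "4 * real_of_int \<mu> = real n - 1" using w by simp
    then show ?thesis by linarith
  qed
  then have "[int n = 1] (mod 4)" unfolding cong_iff_dvd_diff by (metis dvd_triv_left)
  then have "[n = 1] (mod 4)" using cong_int_iff[of n 1 4] by simp
  ultimately show ?thesis by simp
qed

section \<open>Solutions from partitions into blocks\<close>

text \<open>\<open>c i\<close> labels the block of \<open>i\<close>. In a block of size
  \<open>m \<ge> 2\<close> the value is chosen so that \<open>m - 1\<close> copies of it balance the
  \<open>n - m\<close> entries \<open>- 1\<close> of a row.\<close>

definition partition_mat :: "nat \<Rightarrow> (nat \<Rightarrow> nat) \<Rightarrow> real mat" where
  "partition_mat n c = mat n n (\<lambda>(i, j). if i = j then 0 else if c i = c j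
     then (real n - real (card {l. l < n \<and> c l = c i})) / (real (card {l. l < n \<and> c l = c i}) - 1)
     else - 1)"

text \<open>Up to the diagonal the matrix is constant on blocks, so a row applied to a vector sees
  only a block sum, the total and one coordinate (\<open>row\<close>). For a column of the matrix
  the total is 0 and the block sum is given by \<open>blk\<close>.\<close>

lemma partition_solution:
  assumes "\<And>i. i < n \<Longrightarrow> card {l. l < n \<and> c l = c i} \<ge> 2"
  shows "is_solution n (partition_mat n c) (real n - 1)"
proof -
  define m where "m = (\<lambda>i. card {l. l < n \<and> c l = c i})"
  define S where "S = partition_mat n c"
  have m2: "m i \<ge> 2" if "i < n" for i using assms[OF that] by (simp add: m_def)
  define a where "a = (\<lambda>i. (real n - real (m i)) / (real (m i) - 1))"
  define h where "h = (\<lambda>i j. if i = j then 0 else if c i = c j then a i else - 1)"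
  have Sh: "S $$ (i, j) = h i j" if "i < n" "j < n" for i j
    using that by (simp add: S_def partition_mat_def h_def a_def m_def)
  have ac: "a i = a j" if "c i = c j" for i j using that by (simp add: a_def m_def)
  have sym: "h i j = h j i" for i j using ac[of i j] by (auto simp: h_def)
  have aw: "(real (m i) - 1) * a i = real n - real (m i)" if "i < n" for i
    using m2[OF that] by (simp add: a_def)
  have blk: "(\<Sum>l | l < n \<and> c l = c i. h j l) = (if c i = c j then real n - real (m i) else - real (m i))"
    if "i < n" "j < n" for i j
  proof (cases "c i = c j")
    case True
    have "(\<Sum>l | l < n \<and> c l = c i. h j l) = (\<Sum>l | l < n \<and> c l = c i. a i - (if l = j then a i else 0))"
      using True ac[OF True] by (intro sum.cong) (auto simp: h_def)
    also have "\<dots> = real (m i) * a i - a i" using True that by (simp add: sum_subtractf m_def)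
    finally show ?thesis using aw[OF that(1)] True by (simp add: algebra_simps)
  next
    case False
    have "(\<Sum>l | l < n \<and> c l = c i. h j l) = (\<Sum>l | l < n \<and> c l = c i. - 1)"
      using False by (intro sum.cong) (auto simp: h_def)
    then show ?thesis using False by (simp add: m_def)
  qed
  have row: "(\<Sum>l<n. h i l * x l) =
      (a i + 1) * (\<Sum>l | l < n \<and> c l = c i. x l) - (\<Sum>l<n. x l) - a i * x i"
    if i: "i < n" for i and x :: "nat \<Rightarrow> real"
  proof -
    have "(\<Sum>l<n. h i l * x l) = (\<Sum>l<n. (a i + 1) * (if c l = c i then x l else 0) - x l
        - (if l = i then a i * x i else 0))"
      by (intro sum.cong) (auto simp: h_def algebra_simps)
    also have "\<dots> = (a i + 1) * (\<Sum>l<n. if c l = c i then x l else 0) - (\<Sum>l<n. x l) - a i * x i"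
      using i by (simp add: sum_subtractf sum_distrib_left)
    also have "(\<Sum>l<n. if c l = c i then x l else 0) = (\<Sum>l | l < n \<and> c l = c i. x l)"
      by (intro sum.mono_neutral_cong_right) auto
    finally show ?thesis .
  qed
  have sum0: "(\<Sum>l<n. h i l) = 0" if "i < n" for i
  proof -
    have "(\<Sum>l<n. h i l) = (a i + 1) * real (m i) - real n - a i"
      using row[OF that, of "\<lambda>_. 1"] by (simp add: m_def)
    then show ?thesis using aw[OF that] by (simp add: algebra_simps)
  qed
  have quad: "(h i j)\<^sup>2 + (\<Sum>l<n. h i l * h l j) = (real n - 1) * h i j"
    if ij: "i < n" "j < n" "i \<noteq> j" for i j
  proof -
    have "(\<Sum>l<n. h i l * h l j) = (\<Sum>l<n. h i l * h j l)" by (simp add: sym)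
    also have "\<dots> = (a i + 1) * (if c i = c j then real n - real (m i) else - real (m i)) - a i * h j i"
      using row[OF ij(1)] blk[OF ij(1,2)] sum0[OF ij(2)] by simp
    finally have e: "(\<Sum>l<n. h i l * h l j) = \<dots>" .
    \<comment> \<open>Inside a block the square of \<open>a i\<close> cancels against the diagonal
      correction, leaving \<open>(a + 1) * (n - m)\<close>; between blocks
      \<open>(m - 1) * a = n - m\<close> suffices.\<close>
    show ?thesis
    proof (cases "c i = c j")
      case True
      have "(a i + 1) * (real n - real (m i)) = (real n - 1) * a i"
      proof -
        have "(a i + 1) * ((real (m i) - 1) * a i) = ((real (m i) - 1) * a i + (real (m i) - 1)) * a i"
          by (simp add: algebra_simps)
        then show ?thesis unfolding aw[OF ij(1)] by simp
      qed
      then show ?thesis unfolding e using True ij ac[OF True] by (simp add: h_def power2_eq_square)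
    next
      case False
      then show ?thesis unfolding e using ij aw[OF ij(1)] by (simp add: h_def algebra_simps)
    qed
  qed
  have "is_solution n S (real n - 1)" unfolding is_solution_iff
  proof (intro conjI allI impI)
    fix i j assume "i < n" "j < n"
    then show "S $$ (i, j) = S $$ (j, i)" using sym[of i j] by (simp add: Sh)
  next
    fix i j assume "i < n" "j < n" "i \<noteq> j"
    then show "(S $$ (i, j))\<^sup>2 + (\<Sum>l<n. S $$ (i, l) * S $$ (l, j)) = (real n - 1) * S $$ (i, j)"
      using quad[of i j] by (simp add: Sh)
  next
    fix i assume "i < n"
    then show "(\<Sum>l<n. S $$ (i, l)) = 0" using sum0[of i] by (simp add: Sh)
  next
    fix i assume "i < n"
    then show "S $$ (i, i) = 0" by (simp add: Sh h_def)
  qed (simp add: S_def partition_mat_def)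
  then show ?thesis unfolding S_def .
qed

lemma exists_theta_hat_nonzero:
  assumes "n \<ge> 4"
  shows "\<exists>S \<theta>. is_solution n S \<theta> \<and> S \<noteq> 0\<^sub>m n n \<and> theta_hat S \<theta> \<noteq> 0"
proof -
  \<comment> \<open>The blocks are \<open>{0, 1}\<close> and the rest, which has at least two
    elements as \<open>n \<ge> 4\<close>.\<close>
  define c :: "nat \<Rightarrow> nat" where "c = (\<lambda>i. if i < 2 then 0 else 1)"
  define S where "S = partition_mat n c"
  have "card {l. l < n \<and> c l = c i} \<ge> 2" for i
  proof -
    have "(if i < 2 then {0, 1} else {2, 3}) \<subseteq> {l. l < n \<and> c l = c i}"
      using assms by (auto simp: c_def)
    then have "card (if i < 2 then {0, 1} else {2, 3 :: nat}) \<le> card {l. l < n \<and> c l = c i}"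
      by (intro card_mono) auto
    then show ?thesis by (auto split: if_splits)
  qed
  then have sol: "is_solution n S (real n - 1)"
    unfolding S_def by (intro partition_solution)
  have S02: "S $$ (0, 2) = - 1" using assms by (simp add: S_def partition_mat_def c_def)
  then have "S \<noteq> 0\<^sub>m n n" using assms by auto
  \<comment> \<open>A zero norm would make the quotient \<open>theta_hat\<close> equal to 0.\<close>
  moreover have "norm2_mat S > 0"
  proof -
    have "(S $$ (0, 2))\<^sup>2 \<le> (\<Sum>j<n. (S $$ (0, j))\<^sup>2)"
      using assms by (intro member_le_sum) auto
    also have "\<dots> \<le> (\<Sum>i<n. \<Sum>j<n. (S $$ (i, j))\<^sup>2)"
      using assms by (intro member_le_sum) (auto intro: sum_nonneg)
    finally show ?thesis using S02 by (simp add: norm2_mat_def S_def partition_mat_def)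
  qed
  ultimately show ?thesis using sol assms
    by (intro exI[of _ S] exI[of _ "real n - 1"]) (auto simp: theta_hat_def)
qed

lemma two_valued_composite:
  assumes m: "1 < m" and l: "1 < l"
  shows "\<exists>S \<theta>. two_valued_solution (m * l) S \<theta>"
proof -
  define n where "n = m * l"
  \<comment> \<open>Intervals of length \<open>l\<close> form \<open>m\<close> blocks;
    \<open>l > 1\<close> makes them large enough and \<open>m > 1\<close> makes the value
    \<open>- 1\<close> occur.\<close>
  define c :: "nat \<Rightarrow> nat" where "c = (\<lambda>i. i div l)"
  define S where "S = partition_mat n c"
  have block: "card {x. x < n \<and> c x = c i} = l" if "i < n" for i
  proof -
    have "i div l < m" using that l by (simp add: n_def less_mult_imp_div_less)
    then have "Suc (i div l) * l \<le> m * l" by (intro mult_le_mono1) simp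
    then have le: "(i div l) * l + l \<le> n" by (simp add: n_def)
    have iff: "x div l = i div l \<longleftrightarrow> (i div l) * l \<le> x \<and> x < (i div l) * l + l" for x
    proof
      assume "x div l = i div l"
      then have "x = (i div l) * l + x mod l" by (metis div_mult_mod_eq)
      moreover have "x mod l < l" using l by simp
      ultimately show "(i div l) * l \<le> x \<and> x < (i div l) * l + l" by linarith
    next
      assume "(i div l) * l \<le> x \<and> x < (i div l) * l + l"
      then show "x div l = i div l" by (intro div_nat_eqI) (auto simp: mult.commute)
    qed
    have "{x. x < n \<and> c x = c i} = {(i div l) * l ..< (i div l) * l + l}"
    proof (rule Set.set_eqI)
      fix x
      show "x \<in> {x. x < n \<and> c x = c i} \<longleftrightarrow> x \<in> {(i div l) * l ..< (i div l) * l + l}"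
        unfolding c_def mem_Collect_eq atLeastLessThan_iff using iff[of x] le by linarith
    qed
    then show ?thesis by simp
  qed
  have sol: "is_solution n S (real n - 1)"
    unfolding S_def using block l by (intro partition_solution) auto
  have gt: "n > l" using m l by (simp add: n_def)
  define v where "v = (real n - real l) / (real l - 1)"
  have v: "v > 0" using gt l by (simp add: v_def)
  have entry: "S $$ (i, j) = (if c i = c j then v else - 1)" if "i < n" "j < n" "i \<noteq> j" for i j
    using that block by (simp add: S_def partition_mat_def v_def)
  have "offdiag_values n S = {v, - 1}"
  proof
    show "offdiag_values n S \<subseteq> {v, - 1}" using entry by (auto simp: offdiag_values_def)
    have "S $$ (0, 1) = v" "S $$ (0, l) = - 1" using entry[of 0 1] entry[of 0 l] gt l by (auto simp: c_def)
    moreover have "0 < n" "1 < n" "l \<noteq> 0" using gt l by auto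
    moreover have "S $$ (0, j) \<in> offdiag_values n S" if "j < n" "j \<noteq> 0" for j
      using that \<open>0 < n\<close> unfolding offdiag_values_def by blast
    ultimately show "{v, - 1} \<subseteq> offdiag_values n S" using gt by (metis insert_subset empty_subsetI zero_neq_one)
  qed
  then have "card (offdiag_values n S) = 2" using v by simp
  then show ?thesis using sol unfolding two_valued_solution_def n_def by blast
qed

section \<open>Legendre symbol sums and the Paley matrix\<close>

text \<open>Multiplication by a unit followed by a shift permutes the residues modulo
  \<open>n\<close>.\<close>

lemma sum_affine_residues:
  fixes n a b :: int and F :: "int \<Rightarrow> 'a :: comm_monoid_add"
  assumes n: "n > 0" and per: "\<And>x. F (x mod n) = F x" and cop: "coprime a n"
  shows "(\<Sum>x\<in>{0..<n}. F (a * x + b)) = (\<Sum>x\<in>{0..<n}. F x)"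
proof -
  let ?g = "\<lambda>x. (a * x + b) mod n"
  have inj: "inj_on ?g {0..<n}"
  proof (rule inj_onI)
    fix x y assume x: "x \<in> {0..<n}" and y: "y \<in> {0..<n}" and e: "?g x = ?g y"
    from e have "[a * x + b = a * y + b] (mod n)" by (simp add: cong_def)
    then have "[x = y] (mod n)" using cop by (simp add: cong_add_rcancel cong_mult_lcancel)
    then show "x = y" using x y by (simp add: cong_def)
  qed
  have sub: "?g ` {0..<n} \<subseteq> {0..<n}" using n by auto
  have "?g ` {0..<n} = {0..<n}" by (rule endo_inj_surj[OF _ sub inj]) simp
  then have "bij_betw ?g {0..<n} {0..<n}" using inj by (simp add: bij_betw_def)
  from sum.reindex_bij_betw[OF this, of F] show ?thesis by (simp add: per)
qed

lemma Legendre_mod: "Legendre (a mod p) p = Legendre a p"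
  unfolding Legendre_def QuadRes_def by (simp add: cong_def)

text \<open>Euler's criterion gives a congruence modulo \<open>p\<close>; both sides lie in
  \<open>{-1, 0, 1}\<close>, so they differ by at most 2, less than \<open>p\<close>.\<close>

lemma Legendre_mult:
  fixes p :: nat
  assumes "prime p" "2 < p"
  shows "Legendre (a * b) p = Legendre a p * Legendre b p"
proof -
  have "[Legendre (a * b) p = Legendre a p * Legendre b p] (mod p)"
    using euler_criterion[OF assms, of "a * b"]
      cong_mult[OF euler_criterion[OF assms, of a] euler_criterion[OF assms, of b]]
    by (metis cong_sym cong_trans power_mult_distrib)
  moreover have "Legendre x p \<in> {-1, 0, 1}" for x by (auto simp: Legendre_def)
  ultimately have "int p dvd (Legendre (a * b) p - Legendre a p * Legendre b p)"
      "\<bar>Legendre (a * b) p - Legendre a p * Legendre b p\<bar> \<le> 2"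
    by (auto simp: cong_iff_dvd_diff Legendre_def)
  then show ?thesis
    using assms(2) dvd_imp_le_int[of "Legendre (a * b) p - Legendre a p * Legendre b p" "int p"]
    by linarith
qed

text \<open>Otherwise squaring would be onto, hence injective, on the finite set of residues; but 1
  and \<open>p - 1\<close> have the same square.\<close>

lemma exists_nonresidue:
  fixes p :: nat
  assumes p: "prime p" "2 < p"
  obtains z where "Legendre z p = - 1"
proof (rule ccontr)
  assume "\<not> thesis"
  then have all: "Legendre z p \<noteq> - 1" for z using that by blast
  let ?R = "{0..<int p}" and ?g = "\<lambda>x. x\<^sup>2 mod int p"
  have "?R \<subseteq> ?g ` ?R"
  proof
    fix z assume z: "z \<in> ?R"
    have "\<exists>y. [y\<^sup>2 = z] (mod int p)"
    proof (cases "[z = 0] (mod int p)")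
      case True then show ?thesis by (intro exI[of _ 0]) (simp add: cong_sym)
    next
      case False
      then have "QuadRes (int p) z" using all[of z] by (metis Legendre_def)
      then show ?thesis by (simp add: QuadRes_def)
    qed
    then obtain y where "[y\<^sup>2 = z] (mod int p)" by blast
    then have "?g (y mod int p) = z" using z by (simp add: cong_def power_mod)
    moreover have "y mod int p \<in> ?R" using p by simp
    ultimately show "z \<in> ?g ` ?R" by blast
  qed
  then have inj: "inj_on ?g ?R" by (intro finite_surj_inj) auto
  have "?g 1 = ?g (int p - 1)"
  proof -
    have "(int p - 1)\<^sup>2 = 1 + (int p - 2) * int p" by (simp add: power2_eq_square algebra_simps)
    then show ?thesis by simp
  qed
  from inj_onD[OF inj this] have "1 = int p - 1" using p by simp
  then show False using p by simp
qed

text \<open>Scaling the argument by a nonresidue permutes the residues and flips every sign, so the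
  sum equals its negative.\<close>

lemma sum_Legendre:
  fixes p :: nat
  assumes p: "prime p" "2 < p"
  shows "(\<Sum>x\<in>{0..<int p}. Legendre x p) = 0"
proof -
  obtain z where z: "Legendre z p = - 1" using exists_nonresidue[OF p] .
  then have "\<not> int p dvd z" by (auto simp: Legendre_def cong_0_iff split: if_splits)
  then have "coprime z (int p)" using p by (metis coprime_commute prime_imp_coprime prime_nat_int_transfer)
  then have "(\<Sum>x\<in>{0..<int p}. Legendre (z * x + 0) p) = (\<Sum>x\<in>{0..<int p}. Legendre x p)"
    using p by (intro sum_affine_residues) (auto simp: Legendre_mod)
  then have "- (\<Sum>x\<in>{0..<int p}. Legendre x p) = (\<Sum>x\<in>{0..<int p}. Legendre x p)"
    using z by (simp add: Legendre_mult[OF p] sum_negf)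
  then show ?thesis by simp
qed

text \<open>The sum does not depend on the residue \<open>c \<noteq> 0\<close>, and the sum over all \<open>c\<close> vanishes.\<close>
lemma sum_Legendre_shift:
  fixes p :: nat
  assumes p: "prime p" "2 < p" and c: "\<not> int p dvd c"
  shows "(\<Sum>x\<in>{0..<int p}. Legendre x p * Legendre (x + c) p) = - 1"
proof -
  let ?R = "{0..<int p}"
  let ?T = "\<lambda>c. \<Sum>x\<in>?R. Legendre x p * Legendre (x + c) p"
  have per: "Legendre (x mod int p) p * Legendre (x mod int p + c) p = Legendre x p * Legendre (x + c) p" for x c
    by (metis Legendre_mod mod_add_left_eq)
  have sq: "Legendre c p * Legendre c p = 1" if "\<not> int p dvd c" for c
    using that by (auto simp: Legendre_def cong_0_iff)
  have indep: "?T c = ?T 1" if c: "\<not> int p dvd c" for c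
  proof -
    have "coprime c (int p)" using p c by (metis coprime_commute prime_imp_coprime prime_nat_int_transfer)
    \<comment> \<open>Substituting \<open>c * x\<close> for \<open>x\<close> pulls out the factor
      \<open>Legendre c p\<close> twice.\<close>
    then have "?T c = (\<Sum>x\<in>?R. Legendre (c * x + 0) p * Legendre (c * x + 0 + c) p)"
      using p per by (subst sum_affine_residues[where F = "\<lambda>x. Legendre x p * Legendre (x + c) p"]) auto
    also have "\<dots> = (\<Sum>x\<in>?R. (Legendre c p * Legendre c p) * (Legendre x p * Legendre (x + 1) p))"
    proof (rule sum.cong)
      fix x
      have "c * x + 0 + c = c * (x + 1)" "c * x + 0 = c * x" by (simp_all add: algebra_simps)
      then show "Legendre (c * x + 0) p * Legendre (c * x + 0 + c) p
          = (Legendre c p * Legendre c p) * (Legendre x p * Legendre (x + 1) p)"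
        by (simp only: Legendre_mult[OF p] mult.assoc mult.left_commute)
    qed simp
    finally show ?thesis using sq[OF c] by simp
  qed
  have "(\<Sum>c\<in>?R. ?T c) = (\<Sum>x\<in>?R. Legendre x p * (\<Sum>c\<in>?R. Legendre (1 * c + x) p))"
    by (subst sum.swap) (simp add: sum_distrib_left add.commute)
  also have "\<dots> = 0"
    using p sum_Legendre[OF p] by (subst sum_affine_residues) (auto simp: Legendre_mod)
  finally have "(\<Sum>c\<in>?R. ?T c) = 0" .
  moreover have R: "?R = insert 0 {1..<int p}" using p by auto
  have "(\<Sum>c\<in>?R. ?T c) = ?T 0 + (\<Sum>c\<in>{1..<int p}. ?T c)"
    by (subst (1) R) simp
  \<comment> \<open>Shift 0 contributes 1 for every nonzero \<open>x\<close>; each of the other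
    \<open>p - 1\<close> shifts contributes \<open>?T 1\<close>.\<close>
  moreover have "?T 0 = int p - 1"
  proof -
    have "?T 0 = (\<Sum>x\<in>{1..<int p}. Legendre x p * Legendre x p)"
      by (subst R) (simp add: Legendre_def)
    also have "\<dots> = (\<Sum>x\<in>{1..<int p}. 1)"
      by (intro sum.cong refl sq) (simp add: zdvd_not_zless)
    finally show ?thesis using p by simp
  qed
  moreover have "(\<Sum>c\<in>{1..<int p}. ?T c) = (\<Sum>c\<in>{1..<int p}. ?T 1)"
    by (intro sum.cong refl indep) (simp add: zdvd_not_zless)
  ultimately have "(int p - 1) * (?T 1 + 1) = 0" using p by (simp add: algebra_simps)
  then have "?T 1 = - 1" using p by simp
  then show ?thesis using indep[OF c] by simp
qed

text \<open>Off the diagonal the squared entries are 1 and the entries of \<open>S\<^sup>2\<close>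
  are \<open>- 1\<close>, so they cancel and \<open>\<theta> = 0\<close> works.\<close>

lemma two_valued_paley:
  fixes p :: nat
  assumes p: "prime p" "2 < p" and p1: "[p = 1] (mod 4)"
  shows "\<exists>S \<theta>. two_valued_solution p S \<theta>"
proof -
  let ?\<chi> = "\<lambda>x. Legendre x (int p)"
  define S where "S = mat p p (\<lambda>(i, j). real_of_int (?\<chi> (int i - int j)))"
  have R: "(\<Sum>l<p. F (int l)) = (\<Sum>x\<in>{0..<int p}. F x)" for F :: "int \<Rightarrow> int"
    by (rule sum.reindex_bij_witness[of _ nat int]) auto
  have S: "S $$ (i, j) = real_of_int (?\<chi> (int i - int j))" if "i < p" "j < p" for i j
    using that by (simp add: S_def)
  \<comment> \<open>The congruence modulo 4 makes the exponent in Euler's criterion even, so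
    \<open>- 1\<close> is a quadratic residue and \<open>S\<close> is symmetric.\<close>
  have even: "even ((p - 1) div 2)"
    using p1 p by (auto simp: cong_def) presburger
  have "[?\<chi> (- 1) = 1] (mod int p)"
    using euler_criterion[OF p, of "- 1"] even by simp
  then have "int p dvd ?\<chi> (- 1) - 1" by (simp add: cong_iff_dvd_diff)
  then have m1: "?\<chi> (- 1) = 1"
    using p zdvd_not_zless[of 1 "int p"] zdvd_not_zless[of 2 "int p"]
    by (auto simp: Legendre_def split: if_splits)
  have sym: "?\<chi> (x - y) = ?\<chi> (y - x)" for x y
    using Legendre_mult[OF p, of "- 1" "y - x"] m1 by simp
  have ne: "\<not> int p dvd int i - int j" if "i < p" "j < p" "i \<noteq> j" for i j
    using dvd_imp_le_int[of "int i - int j" "int p"] that by auto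
  have sq: "(?\<chi> c)\<^sup>2 = 1" if "\<not> int p dvd c" for c
    using that by (auto simp: Legendre_def cong_0_iff)
  have row: "(\<Sum>l<p. ?\<chi> (int i - int l)) = 0" for i
  proof -
    have "(\<Sum>l<p. ?\<chi> (int i - int l)) = (\<Sum>x\<in>{0..<int p}. ?\<chi> ((- 1) * x + int i))"
      by (subst R) (simp add: algebra_simps)
    then show ?thesis
      using p sum_Legendre[OF p] by (subst (asm) sum_affine_residues) (auto simp: Legendre_mod)
  qed
  have quad: "(\<Sum>l<p. ?\<chi> (int i - int l) * ?\<chi> (int l - int j)) = - 1"
    if "i < p" "j < p" "i \<noteq> j" for i j
  proof -
    \<comment> \<open>With \<open>x = l - i\<close> and the symmetry of the symbol, this is the
      shifted sum for the shift \<open>i - j\<close>.\<close>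
    let ?F = "\<lambda>x. ?\<chi> x * ?\<chi> (x + (int i - int j))"
    have "(\<Sum>l<p. ?\<chi> (int i - int l) * ?\<chi> (int l - int j))
        = (\<Sum>x\<in>{0..<int p}. ?F (1 * x + (- int i)))"
      by (subst R) (simp add: sym[of "int i"])
    also have "\<dots> = (\<Sum>x\<in>{0..<int p}. ?F x)"
    proof (rule sum_affine_residues)
      show "?F (x mod int p) = ?F x" for x by (metis Legendre_mod mod_add_left_eq)
    qed (use p in auto)
    finally show ?thesis using sum_Legendre_shift[OF p ne[OF that]] by simp
  qed
  have "is_solution p S 0"
    unfolding is_solution_iff
  proof (intro conjI allI impI)
    fix i j assume ij: "i < p" "j < p" "i \<noteq> j"
    have "(\<Sum>l<p. S $$ (i, l) * S $$ (l, j)) =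
      real_of_int (\<Sum>l<p. ?\<chi> (int i - int l) * ?\<chi> (int l - int j))"
      using ij by (simp add: S)
    moreover have "(S $$ (i, j))\<^sup>2 = real_of_int ((?\<chi> (int i - int j))\<^sup>2)" using ij by (simp add: S)
    ultimately show "(S $$ (i, j))\<^sup>2 + (\<Sum>l<p. S $$ (i, l) * S $$ (l, j)) = 0 * S $$ (i, j)"
      using quad[OF ij] sq[OF ne[OF ij]] by simp
  next
    fix i assume "i < p"
    then have "(\<Sum>l<p. S $$ (i, l)) = real_of_int (\<Sum>l<p. ?\<chi> (int i - int l))" by (simp add: S)
    then show "(\<Sum>l<p. S $$ (i, l)) = 0" using row by simp
  next
    fix i j assume "i < p" "j < p"
    then show "S $$ (i, j) = S $$ (j, i)" using sym[of "int i" "int j"] by (simp add: S)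
  next
    fix i assume "i < p"
    then show "S $$ (i, i) = 0" by (simp add: S Legendre_def)
  qed (simp add: S_def)
  moreover have "offdiag_values p S = {1, - 1}"
  proof
    show "offdiag_values p S \<subseteq> {1, - 1}"
    proof
      fix v assume "v \<in> offdiag_values p S"
      then obtain i j where ij: "i < p" "j < p" "i \<noteq> j" and v: "v = S $$ (i, j)"
        by (auto simp: offdiag_values_def)
      show "v \<in> {1, - 1}" using sq[OF ne[OF ij]] v ij by (auto simp: S power2_eq_1_iff)
    qed
    \<comment> \<open>Column 0 already contains the symbol of every nonzero residue.\<close>
    have mem: "real_of_int (?\<chi> x) \<in> offdiag_values p S" if "\<not> int p dvd x" for x
    proof -
      define i where "i = nat (x mod int p)"
      have i: "int i = x mod int p" using p by (simp add: i_def)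
      have "i < p" using p by (simp add: i_def nat_less_iff)
      moreover have "i \<noteq> 0" using i that by (auto simp: dvd_eq_mod_eq_0)
      moreover have "S $$ (i, 0) = real_of_int (?\<chi> x)" using \<open>i < p\<close> i p by (simp add: S Legendre_mod)
      moreover have "0 < p" using p by simp
      ultimately show ?thesis unfolding offdiag_values_def mem_Collect_eq by metis
    qed
    obtain z where z: "?\<chi> z = - 1" using exists_nonresidue[OF p] .
    then have "\<not> int p dvd z" by (auto simp: Legendre_def cong_0_iff split: if_splits)
    then have "- 1 \<in> offdiag_values p S" using mem[of z] z by simp
    moreover have "1 \<in> offdiag_values p S" using mem[of "- 1"] m1 p by simp
    ultimately show "{1, - 1} \<subseteq> offdiag_values p S" by simp
  qed
  ultimately show ?thesis unfolding two_valued_solution_def by auto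
qed

theorem theorem3p2:
  fixes n :: nat
  assumes "n \<ge> 4"
  shows "(\<exists>S \<theta>. is_solution n S \<theta> \<and> S \<noteq> 0\<^sub>m n n \<and> theta_hat S \<theta> \<noteq> 0) \<and>
         ((\<exists>S \<theta>. two_valued_solution n S \<theta>) \<longleftrightarrow>
            (\<exists>m l. 1 < m \<and> 1 < l \<and> n = m * l) \<or> (prime n \<and> [n = 1] (mod 4))) \<and>
         (prime n \<longrightarrow> (\<forall>S \<theta>. two_valued_solution n S \<theta> \<longrightarrow> theta_hat S \<theta> = 0))"
proof -
  \<comment> \<open>A non-prime \<open>n\<close> is composite, so the converse is at stake only for
    primes; there \<open>\<theta> = 0\<close> also gives
    \<open>theta_hat S \<theta> = 0\<close>.\<close>
  have "prime n \<or> (\<exists>m l. 1 < m \<and> 1 < l \<and> n = m * l)"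
  proof (cases "prime n")
    case False
    then obtain m where m: "m dvd n" "m \<noteq> 1" "m \<noteq> n" using assms by (auto simp: prime_nat_iff)
    then obtain l where l: "n = m * l" by blast
    then have "m > 1" "l > 1" using m assms by (auto intro!: Suc_lessI Nat.gr0I)
    then show ?thesis using l by blast
  qed simp
  then show ?thesis
    using exists_theta_hat_nonzero[OF assms] two_valued_composite two_valued_paley[of n]
      two_valued_prime[of n] assms
    by (auto simp: theta_hat_def)
qed

end
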